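(* Let $k\ge1$ and let $m_1,\dots,m_k\ge 1$ be integers. Consider $k$ independent theaters, theater $i$ in state $r_i\in\mathbb{Z}_{\ge0}$ with escalation set $S_i=\{1,\dots,m_i\}$. On each turn the player to move selects exactly one theater $i$ and subtracts from $r_i$ some $d\in S_i$ with $d\le r_i$. Let $G_i(r)$ denote the normal-play Grundy value of state $r$ in theater $i$ played alone. Under normal play, the joint state $(r_1,\dots,r_k)$ is a $\mathcal{P}$-position if and only if $$\bigoplus_{i=1}^{k} G_i(r_i)\;=\;\bigoplus_{i=1}^{k}\bigl(r_i \bmod (m_i+1)\bigr)\;=\;0,$$ where $\oplus$ denotes bitwise exclusive-or (Nim-sum).
   Context: The game is a two-player game with alternating turns. Normal play: a player unable to move loses. The only terminal joint state is $(0,\dots,0)$. A joint state is a $\mathcal{P}$-position (the player to move loses) if and only if every joint state reachable by one legal move is an $\mathcal{N}$-position; it is an $\mathcal{N}$-position if and only if some joint state reachable by one legal move is a $\mathcal{P}$-position. In particular the terminal state is a $\mathcal{P}$-position. The Grundy value of a single theater is defined recursively by $G_i(r)=\operatorname{mex}\{G_i(r-d): d\in S_i,\ d\le r\}$, where $\operatorname{mex}A$ is the least nonnegative integer not in $A$. The expression $r\bmod (m+1)$ denotes the remainder in $\{0,1,\dots,m\}$. The displayed condition includes the assertion that the two Nim-sums are equal (which is claimed to hold for every joint state). *)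

theory Defs
  imports Main
begin

definition escalation_set :: "nat \<Rightarrow> nat set" where
  "escalation_set m = {1..m}"

definition mex :: "nat set \<Rightarrow> nat" where
  "mex A = (LEAST n. n \<notin> A)"

text \<open>Grundy value of state \<open>r\<close> in a single theater with escalation set \<open>{1, \<dots>, m}\<close>.\<close>

function grundy :: "nat \<Rightarrow> nat \<Rightarrow> nat" where
  "grundy m r = mex ((\<lambda>d. grundy m (r - d)) ` {d \<in> escalation_set m. d \<le> r})"
  by pat_completeness auto
termination
  by (relation "measure snd") (auto simp: escalation_set_def)

declare grundy.simps [simp del]

definition nim_sum :: "nat list \<Rightarrow> nat" where
  "nim_sum xs = foldr xor xs 0"

text \<open>
  A joint state of \<open>k\<close> theaters is a list \<open>rs\<close> of length \<open>k\<close>, and \<open>ms\<close> lists the parameters of the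
  theaters; theater number \<open>i\<close> of the usual numbering \<open>1, \<dots>, k\<close> is at list index \<open>i - 1\<close>.
\<close>

definition legal_move :: "nat list \<Rightarrow> nat list \<Rightarrow> nat list \<Rightarrow> bool" where
  "legal_move ms rs rs' \<longleftrightarrow>
     (\<exists>i < length rs. \<exists>d \<in> escalation_set (ms ! i). d \<le> rs ! i \<and> rs' = rs[i := rs ! i - d])"

text \<open>
  The least solution of the defining equivalences (\<open>P_position_iff\<close>, \<open>N_position_iff\<close> below). Since
  every play is finite, it is the only one, and every joint state has exactly one of the two outcomes
  (\<open>N_position_iff_not_P_position\<close>).
\<close>

inductive P_position :: "nat list \<Rightarrow> nat list \<Rightarrow> bool"
  and N_position :: "nat list \<Rightarrow> nat list \<Rightarrow> bool"
  for ms :: "nat list" where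
  P: "(\<And>rs'. legal_move ms rs rs' \<Longrightarrow> N_position ms rs') \<Longrightarrow> P_position ms rs"
| N: "legal_move ms rs rs' \<Longrightarrow> P_position ms rs' \<Longrightarrow> N_position ms rs"

lemma P_position_iff:
  "P_position ms rs \<longleftrightarrow> (\<forall>rs'. legal_move ms rs rs' \<longrightarrow> N_position ms rs')"
  by (subst P_position.simps) blast

lemma N_position_iff:
  "N_position ms rs \<longleftrightarrow> (\<exists>rs'. legal_move ms rs rs' \<and> P_position ms rs')"
  by (subst N_position.simps) blast

lemma legal_move_sum_list_less:
  assumes "legal_move ms rs rs'"
  shows "sum_list rs' < sum_list rs"
proof -
  obtain i d where i: "i < length rs" and d: "1 \<le> d" "d \<le> rs ! i"
    and rs': "rs' = rs[i := rs ! i - d]"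
    using assms by (auto simp: legal_move_def escalation_set_def)
  have "rs ! i \<le> sum_list rs"
    using i by (simp add: member_le_sum_list)
  then show ?thesis
    using i d rs' by (simp add: sum_list_update)
qed

lemma N_position_iff_not_P_position: "N_position ms rs \<longleftrightarrow> \<not> P_position ms rs"
proof (induction "sum_list rs" arbitrary: rs rule: less_induct)
  case less
  then have "N_position ms rs' \<longleftrightarrow> \<not> P_position ms rs'" if "legal_move ms rs rs'" for rs'
    using that legal_move_sum_list_less by blast
  then show ?case
    unfolding N_position_iff [of ms rs] P_position_iff [of ms rs] by blast
qed

end

theory Submission
  imports Defs
begin

text \<open>
  This is the Sprague--Grundy theorem for a sum of bounded subtraction games.

  In a single theater a move always changes the residue of the state modulo \<open>m + 1\<close>, since it
  subtracts at least \<open>1\<close> and at most \<open>m\<close>, and it can turn that residue into any smaller one. By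
  induction the Grundy value is this residue (\<open>grundy_eq_mod\<close>), which gives the equality of the two
  Nim-sums term by term.

  For the joint game only two properties of a mex are used: no move preserves the Grundy value of
  its theater, and every smaller value is the Grundy value of an option. A move in one theater
  changes the Nim-sum by the exclusive-or of the old and the new Grundy value there. Hence no move
  leads from Nim-sum \<open>0\<close> to Nim-sum \<open>0\<close>. From a Nim-sum \<open>s \<noteq> 0\<close>, Bouton's argument
  (\<open>nim_sum_reducible_entry\<close>) finds a theater whose Grundy value \<open>g\<close> exceeds \<open>xor g s\<close>; moving
  there to an option of value \<open>xor g s\<close> makes the Nim-sum \<open>0\<close>. Since plays are finite, these two
  facts identify the positions of Nim-sum \<open>0\<close> with the P-positions
  (\<open>P_position_iff_nim_sum_grundy\<close>).
\<close>

section \<open>Mex and Grundy values\<close>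

lemma mex_eqI:
  assumes "n \<notin> A" and "\<And>v. v < n \<Longrightarrow> v \<in> A"
  shows "mex A = n"
  unfolding mex_def using assms by (intro Least_equality) (auto simp: not_less[symmetric])

lemma mex_notin:
  assumes "finite A"
  shows "mex A \<notin> A"
  unfolding mex_def using ex_new_if_finite[OF infinite_UNIV_nat assms] by (rule LeastI_ex)

lemma less_mex_mem: "v < mex A \<Longrightarrow> v \<in> A"
  unfolding mex_def by (auto dest: not_less_Least)

lemma grundy_option_neq:
  assumes "d \<in> escalation_set m" and "d \<le> r"
  shows "grundy m (r - d) \<noteq> grundy m r"
proof -
  let ?A = "(\<lambda>d. grundy m (r - d)) ` {d \<in> escalation_set m. d \<le> r}"
  have "mex ?A \<notin> ?A"
    by (intro mex_notin) (simp add: escalation_set_def)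
  then have "grundy m r \<notin> ?A"
    by (subst grundy.simps[of m r])
  then show ?thesis
    using assms by (metis (mono_tags, lifting) image_eqI mem_Collect_eq)
qed

lemma grundy_option_attains:
  assumes "v < grundy m r"
  obtains d where "d \<in> escalation_set m" and "d \<le> r" and "grundy m (r - d) = v"
proof -
  have "v \<in> (\<lambda>d. grundy m (r - d)) ` {d \<in> escalation_set m. d \<le> r}"
    using assms by (intro less_mex_mem) (simp flip: grundy.simps)
  then show thesis
    using that by auto
qed

lemma grundy_eq_mod: "grundy m r = r mod (m + 1)"
proof (induction r rule: less_induct)
  case (less r)
  let ?D = "{d \<in> escalation_set m. d \<le> r}"
  have IH: "(\<lambda>d. grundy m (r - d)) ` ?D = (\<lambda>d. (r - d) mod (m + 1)) ` ?D"
    using less.IH by (intro image_cong) (auto simp: escalation_set_def)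
  have "mex ((\<lambda>d. (r - d) mod (m + 1)) ` ?D) = r mod (m + 1)"
  proof (rule mex_eqI)
    \<comment> \<open>Equal residues would make \<open>m + 1\<close> divide \<open>d\<close>, but \<open>0 < d < m + 1\<close>.\<close>
    have "(r - d) mod (m + 1) \<noteq> r mod (m + 1)" if "d \<in> ?D" for d
    proof
      assume eq: "(r - d) mod (m + 1) = r mod (m + 1)"
      have "m + 1 dvd r - (r - d)"
        using eq by (metis diff_le_self mod_eq_dvd_iff_nat)
      then have "m + 1 dvd d"
        using that by simp
      then show False
        using that by (auto simp: escalation_set_def dest: dvd_imp_le)
    qed
    then show "r mod (m + 1) \<notin> (\<lambda>d. (r - d) mod (m + 1)) ` ?D"
      by (metis (no_types, lifting) imageE)
  next
    fix v assume v: "v < r mod (m + 1)"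
    let ?d = "r mod (m + 1) - v"
    have "r mod (m + 1) \<le> m" "r mod (m + 1) \<le> r"
      using mod_less_divisor[of "m + 1" r] by (simp_all del: mod_less_divisor)
    then have d: "?d \<in> ?D"
      using v unfolding escalation_set_def mem_Collect_eq atLeastAtMost_iff by linarith
    have "r - ?d = v + r div (m + 1) * (m + 1)"
      using v div_mult_mod_eq[of r "m + 1"] by linarith
    moreover have "v < m + 1"
      using v \<open>r mod (m + 1) \<le> m\<close> by linarith
    ultimately have "(r - ?d) mod (m + 1) = v"
      by (simp only: mod_mult_self1 mod_less)
    then show "v \<in> (\<lambda>d. (r - d) mod (m + 1)) ` ?D"
      using d by (metis (no_types, lifting) imageI)
  qed
  then show ?case
    by (subst grundy.simps) (simp only: IH)
qed

section \<open>Nim-sums\<close>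

lemma nim_sum_Nil [simp]: "nim_sum [] = 0"
  by (simp add: nim_sum_def)

lemma nim_sum_Cons [simp]: "nim_sum (x # xs) = xor x (nim_sum xs)"
  by (simp add: nim_sum_def)

lemma xor_eq_0_iff: "xor a b = 0 \<longleftrightarrow> a = b" for a b :: nat
  by (metis xor.assoc xor.left_neutral xor_self_eq)

text \<open>
  Exclusive-or with the old entry cancels it, because every number is its own Nim-inverse.
\<close>

lemma nim_sum_list_update:
  "i < length xs \<Longrightarrow> nim_sum (xs[i := y]) = xor (nim_sum xs) (xor (xs ! i) y)"
proof (induction xs arbitrary: i)
  case (Cons x xs)
  show ?case
  proof (cases i)
    case 0
    have "xor x (xor x (xor y (nim_sum xs))) = xor y (nim_sum xs)"
      by (simp flip: xor.assoc)
    with 0 show ?thesis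
      by (simp add: ac_simps)
  next
    case (Suc j)
    with Cons show ?thesis
      by (simp add: ac_simps)
  qed
qed simp

lemma bit_nim_sum_imp_bit_entry:
  "bit (nim_sum xs) n \<Longrightarrow> \<exists>i < length xs. bit (xs ! i) n"
proof (induction xs)
  case (Cons x xs)
  show ?case
  proof (cases "bit x n")
    case False
    with Cons show ?thesis
      by (auto simp: bit_xor_iff)
  qed auto
qed simp

lemma obtain_leading_bit:
  fixes s :: nat
  assumes "s \<noteq> 0"
  obtains n where "bit s n" and "\<And>j. n < j \<Longrightarrow> \<not> bit s j"
proof
  have *: "j \<le> s" if "bit s j" for j
  proof (rule ccontr)
    assume "\<not> j \<le> s"
    then have "s < 2 ^ j"
      using less_exp[of j] by linarith
    with that show False
      by (simp add: bit_iff_odd)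
  qed
  have ex: "\<exists>n. bit s n"
    using assms by (auto simp: bit_eq_iff)
  let ?n = "GREATEST n. bit s n"
  show "bit s ?n"
    using ex * by (auto intro: GreatestI_nat)
  show "\<not> bit s j" if "?n < j" for j
    using that * Greatest_le_nat[of "bit s" j s] by fastforce
qed

lemma less_if_leading_differing_bit:
  fixes x y :: nat
  assumes "bit x n" and "\<not> bit y n" and above: "\<And>j. n < j \<Longrightarrow> bit y j \<longleftrightarrow> bit x j"
  shows "y < x"
proof -
  have "drop_bit (Suc n) y = drop_bit (Suc n) x"
    using above by (auto simp: bit_eq_iff bit_drop_bit_eq)
  then have "y div 2 ^ n div 2 = x div 2 ^ n div 2"
    by (simp only: drop_bit_eq_div power_Suc2 div_mult2_eq)
  moreover have "odd (x div 2 ^ n)" "even (y div 2 ^ n)"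
    using assms(1,2) by (simp_all add: bit_iff_odd)
  ultimately have "y div 2 ^ n < x div 2 ^ n"
    by (elim oddE evenE) simp
  then show ?thesis
    by (meson div_le_mono not_less)
qed

text \<open>
  Some entry \<open>x\<close> has a \<open>1\<close> at the leading bit of the Nim-sum \<open>s\<close>. Passing from \<open>x\<close> to \<open>xor x s\<close>
  clears this bit and changes no higher one.
\<close>

lemma nim_sum_reducible_entry:
  assumes "nim_sum xs \<noteq> 0"
  obtains i where "i < length xs" and "xor (xs ! i) (nim_sum xs) < xs ! i"
proof -
  obtain n where n: "bit (nim_sum xs) n" "\<And>j. n < j \<Longrightarrow> \<not> bit (nim_sum xs) j"
    using obtain_leading_bit[OF assms] by blast
  obtain i where i: "i < length xs" "bit (xs ! i) n"
    using bit_nim_sum_imp_bit_entry n(1) by blast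
  have "xor (xs ! i) (nim_sum xs) < xs ! i"
    by (rule less_if_leading_differing_bit[of _ n]) (use n i in \<open>auto simp: bit_xor_iff\<close>)
  with i that show thesis
    by blast
qed

section \<open>The joint game\<close>

definition grundy_values :: "nat list \<Rightarrow> nat list \<Rightarrow> nat list" where
  "grundy_values ms rs = map (\<lambda>i. grundy (ms ! i) (rs ! i)) [0..<length rs]"

lemma length_grundy_values [simp]: "length (grundy_values ms rs) = length rs"
  by (simp add: grundy_values_def)

lemma nth_grundy_values [simp]:
  "i < length rs \<Longrightarrow> grundy_values ms rs ! i = grundy (ms ! i) (rs ! i)"
  by (simp add: grundy_values_def)

lemma nim_sum_grundy_values_move:
  assumes "i < length rs"
  shows "nim_sum (grundy_values ms (rs[i := r])) =
    xor (nim_sum (grundy_values ms rs)) (xor (grundy (ms ! i) (rs ! i)) (grundy (ms ! i) r))"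
proof -
  have "grundy_values ms (rs[i := r]) = (grundy_values ms rs)[i := grundy (ms ! i) r]"
    using assms by (intro nth_equalityI) (auto simp: nth_list_update)
  with assms show ?thesis
    by (simp add: nim_sum_list_update)
qed

lemma legal_move_from_zero:
  assumes "nim_sum (grundy_values ms rs) = 0" and "legal_move ms rs rs'"
  shows "nim_sum (grundy_values ms rs') \<noteq> 0"
proof -
  obtain i d where "i < length rs" "d \<in> escalation_set (ms ! i)" "d \<le> rs ! i"
    and "rs' = rs[i := rs ! i - d]"
    using assms(2) by (auto simp: legal_move_def)
  then show ?thesis
    using assms(1) grundy_option_neq[of d "ms ! i" "rs ! i"]
    by (simp add: nim_sum_grundy_values_move xor_eq_0_iff)
qed

lemma legal_move_to_zero:
  assumes "nim_sum (grundy_values ms rs) \<noteq> 0"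
  obtains rs' where "legal_move ms rs rs'" and "nim_sum (grundy_values ms rs') = 0"
proof -
  let ?s = "nim_sum (grundy_values ms rs)"
  obtain i where i: "i < length rs"
    and less: "xor (grundy (ms ! i) (rs ! i)) ?s < grundy (ms ! i) (rs ! i)"
    using nim_sum_reducible_entry[OF assms] by auto
  obtain d where d: "d \<in> escalation_set (ms ! i)" "d \<le> rs ! i"
    and eq: "grundy (ms ! i) (rs ! i - d) = xor (grundy (ms ! i) (rs ! i)) ?s"
    using grundy_option_attains[OF less] .
  have "nim_sum (grundy_values ms (rs[i := rs ! i - d])) = 0"
    using i by (simp add: nim_sum_grundy_values_move eq flip: xor.assoc)
  moreover have "legal_move ms rs (rs[i := rs ! i - d])"
    using i d by (auto simp: legal_move_def)
  ultimately show thesis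
    using that by blast
qed

text \<open>
  The positions of Nim-sum \<open>0\<close> satisfy the recursion that determines the P-positions. It determines
  them because every move lowers the total of the states.
\<close>

lemma P_position_iff_nim_sum_grundy:
  "P_position ms rs \<longleftrightarrow> nim_sum (grundy_values ms rs) = 0"
proof (induction "sum_list rs" arbitrary: rs rule: less_induct)
  case less
  have "P_position ms rs \<longleftrightarrow> (\<forall>rs'. legal_move ms rs rs' \<longrightarrow> \<not> P_position ms rs')"
    unfolding P_position_iff[of ms rs] N_position_iff_not_P_position ..
  also have "\<dots> \<longleftrightarrow> (\<forall>rs'. legal_move ms rs rs' \<longrightarrow> nim_sum (grundy_values ms rs') \<noteq> 0)"
    using less legal_move_sum_list_less by blast
  also have "\<dots> \<longleftrightarrow> nim_sum (grundy_values ms rs) = 0"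
    using legal_move_from_zero legal_move_to_zero by metis
  finally show ?case .
qed

theorem theorem5p2:
  fixes k :: nat and ms rs :: "nat list"
  assumes "k \<ge> 1"
    and "length ms = k" and "length rs = k"
    and "\<forall>i < k. ms ! i \<ge> 1"
  shows "nim_sum (map (\<lambda>i. grundy (ms ! i) (rs ! i)) [0..<k])
           = nim_sum (map (\<lambda>i. rs ! i mod (ms ! i + 1)) [0..<k]) \<and>
         (P_position ms rs \<longleftrightarrow>
           nim_sum (map (\<lambda>i. grundy (ms ! i) (rs ! i)) [0..<k])
             = nim_sum (map (\<lambda>i. rs ! i mod (ms ! i + 1)) [0..<k]) \<and>
           nim_sum (map (\<lambda>i. rs ! i mod (ms ! i + 1)) [0..<k]) = 0)"
proof -
  have "P_position ms rs \<longleftrightarrow> nim_sum (map (\<lambda>i. grundy (ms ! i) (rs ! i)) [0..<k]) = 0"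
    using P_position_iff_nim_sum_grundy[of ms rs] \<open>length rs = k\<close>
    by (simp add: grundy_values_def)
  then show ?thesis
    by (simp only: grundy_eq_mod simp_thms)
qed

end
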